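(* Let $\{Q^s\mid s>s_0\}$ be a chain of Banach manifolds with a compatible weak Riemannian metric $\gamma$, and let $\Phi:G\times Q^s\to Q^s$ be an action of a finite dimensional Lie group $G$ satisfying all the hypotheses listed in the context. Let $H$ be a compact subgroup of $G$. Then for all $s>s_0+1$, the $H$-isotropy type set $(Q^s)_H:=\{q\in Q^s\mid G_q=H\}$ is an open subset of the manifold $(Q^s)^H:=\{q\in Q^s\mid G_q\supset H\}$.
   Context: Chain of Banach manifolds: a collection $\{Q^s\mid s>s_0\}$ of smooth Banach manifolds such that for all $r>s>s_0$ there is a smooth inclusion $j_{(r,s)}:Q^r\hookrightarrow Q^s$ with dense range, such that for all $q\in Q^r$ the range of $T_qj_{(r,s)}:T_qQ^r\to T_qQ^s$ is dense in $T_qQ^s$, and such that for each chart $\varphi^s:U^s\to T_qQ^s$ of $Q^s$ at a point $q\in Q^r$, $r>s$, the map $\varphi^r:=\varphi^s|_{U^s\cap Q^r}$ takes values in $T_qQ^r$ and is a chart of $Q^r$. Each $Q^s$ carries a weak Riemannian metric $\gamma_s$ with $j_{(r,s)}^*\gamma_s=\gamma_r$; it is denoted simply $\gamma$. Hypotheses on the action: $G$ is a finite dimensional Lie group; for every $s>s_0$ there is an action $\Phi:G\times Q^s\to Q^s$, $\Phi(g,q)=\Phi_g(q)=\Phi^q(g)$, which is continuous; proper (whenever $(q_n)$ and $(\Phi_{g_n}(q_n))$ converge in $Q^s$, $(g_n)$ has a convergent subsequence in $G$); compatible (each $\Phi_g$ commutes with all $j_{(r,s)}$); and such that (1) for all $s>s_0$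 and $g\in G$, $\Phi_g:Q^s\to Q^s$ is smooth; (2) for all $s>s_0+1$ and $q\in Q^s$, $\Phi^q:G\to Q^{s-1}$ is $C^1$. The isotropy group of $q$ is $G_q:=\{g\in G\mid\Phi_g(q)=q\}$ (compact, by properness). The set $(Q^s)^H$ is a smooth submanifold of $Q^s$ with tangent spaces $\{v_q\in T_qQ^s\mid T_q\Phi_h(v_q)=v_q\ \forall h\in H\}$. *)

theory Defs
  imports "HOL-Analysis.Analysis" "HOL-Algebra.Group_Action"
begin

section \<open>Maps of class C^k between Banach spaces\<close>

text \<open>
  Isabelle/HOL cannot index a family of types by a real number, so the (varying) model spaces of
  all manifolds below are subspaces of one ambient Banach space.  We use the ranges of bounded
  projections; such a range is closed, hence a Banach space.  There is no loss of generality: every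
  set-indexed family of Banach spaces embeds isometrically, each member with a bounded projection
  onto it, into its l1 direct sum.  Thanks to the projection a bounded linear map defined on a model
  space extends to the ambient space, so that the library derivative \<open>at x within S\<close>, for \<open>S\<close> open
  in the model space \<open>E\<close>, is the Frechet derivative on \<open>E\<close> (its values off \<open>E\<close> are irrelevant).
\<close>

definition banach_model :: "'e::banach set \<Rightarrow> bool" where
  "banach_model E \<longleftrightarrow> (\<exists>P. bounded_linear P \<and> range P = E \<and> (\<forall>x. P (P x) = P x))"

text \<open>\<open>n\<close>-linear maps on \<open>E\<close> are functions of lists of length \<open>n\<close> of vectors of \<open>E\<close>;
  \<open>norm_le_on n E m B\<close> says that the operator norm of \<open>m\<close> is at most \<open>B\<close>.\<close>

definition multilinear_on ::
    "nat \<Rightarrow> 'e::real_normed_vector set \<Rightarrow> ('e list \<Rightarrow> 'f::real_normed_vector) \<Rightarrow> bool" where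
  "multilinear_on n E m \<longleftrightarrow>
     (\<forall>us vs x y a b. length us + length vs + 1 = n \<and> set us \<subseteq> E \<and> set vs \<subseteq> E \<and> x \<in> E \<and> y \<in> E \<longrightarrow>
        m (us @ (a *\<^sub>R x + b *\<^sub>R y) # vs) = a *\<^sub>R m (us @ x # vs) + b *\<^sub>R m (us @ y # vs))"

definition norm_le_on ::
    "nat \<Rightarrow> 'e::real_normed_vector set \<Rightarrow> ('e list \<Rightarrow> 'f::real_normed_vector) \<Rightarrow> real \<Rightarrow> bool" where
  "norm_le_on n E m B \<longleftrightarrow>
     (\<forall>vs. length vs = n \<and> set vs \<subseteq> E \<longrightarrow> norm (m vs) \<le> B * prod_list (map norm vs))"

text \<open>\<open>f\<close> is of class \<open>C^k\<close> on the open subset \<open>S\<close> of \<open>E\<close>: there are iterated Frechet derivatives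
  \<open>D n x\<close> (bounded \<open>n\<close>-linear, continuous in \<open>x\<close> for the operator norm) for \<open>n \<le> k\<close>, where
  \<open>D (n+1) x\<close> is the Frechet derivative of \<open>D n\<close> at \<open>x\<close>, the increment being the first argument.\<close>

definition Ck_on ::
    "enat \<Rightarrow> 'e::real_normed_vector set \<Rightarrow> 'e set \<Rightarrow> ('e \<Rightarrow> 'f::real_normed_vector) \<Rightarrow> bool" where
  "Ck_on k E S f \<longleftrightarrow>
     (\<exists>D :: nat \<Rightarrow> 'e \<Rightarrow> 'e list \<Rightarrow> 'f.
        (\<forall>x\<in>S. D 0 x [] = f x) \<and>
        (\<forall>n. enat n \<le> k \<longrightarrow>
           (\<forall>x\<in>S. multilinear_on n E (D n x) \<and> (\<exists>B. norm_le_on n E (D n x) B) \<and>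
              (\<forall>\<epsilon>>0. \<forall>\<^sub>F y in at x within S. norm_le_on n E (\<lambda>vs. D n y vs - D n x vs) \<epsilon>))) \<and>
        (\<forall>n. enat n < k \<longrightarrow>
           (\<forall>x\<in>S. \<forall>\<epsilon>>0. \<forall>\<^sub>F y in at x within S.
              norm_le_on n E (\<lambda>vs. D n y vs - D n x vs - D (Suc n) x ((y - x) # vs))
                (\<epsilon> * norm (y - x)))))"

section \<open>Banach manifolds\<close>

record ('q, 'e) chart =
  cdom :: "'q set"
  cmodel :: "'e set"
  cmap :: "'q \<Rightarrow> 'e"

definition cinv :: "('q, 'e) chart \<Rightarrow> 'e \<Rightarrow> 'q" where
  "cinv c = inv_into (cdom c) (cmap c)"

record ('q, 'e) manifold =
  mtop :: "'q topology"
  atlas :: "('q, 'e) chart set"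

abbreviation points :: "('q, 'e) manifold \<Rightarrow> 'q set" where
  "points M \<equiv> topspace (mtop M)"

definition compatible_charts ::
    "('q, 'e::banach) chart \<Rightarrow> ('q, 'e) chart \<Rightarrow> bool" where
  "compatible_charts c d \<longleftrightarrow>
     Ck_on \<infinity> (cmodel c) (cmap c ` (cdom c \<inter> cdom d)) (cmap d \<circ> cinv c) \<and>
     Ck_on \<infinity> (cmodel d) (cmap d ` (cdom c \<inter> cdom d)) (cmap c \<circ> cinv d)"

text \<open>Membership in the maximal atlas of \<open>M\<close>.  The field \<open>atlas\<close> itself need not be maximal.\<close>

definition chart_of :: "('q, 'e::banach) manifold \<Rightarrow> ('q, 'e) chart \<Rightarrow> bool" where
  "chart_of M c \<longleftrightarrow>
     banach_model (cmodel c) \<and>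
     openin (mtop M) (cdom c) \<and>
     openin (top_of_set (cmodel c)) (cmap c ` cdom c) \<and>
     homeomorphic_map (subtopology (mtop M) (cdom c)) (top_of_set (cmap c ` cdom c)) (cmap c) \<and>
     (\<forall>d\<in>atlas M. compatible_charts c d)"

definition banach_manifold :: "('q, 'e::banach) manifold \<Rightarrow> bool" where
  "banach_manifold M \<longleftrightarrow>
     Hausdorff_space (mtop M) \<and>
     (\<Union>c\<in>atlas M. cdom c) = points M \<and>
     (\<forall>c\<in>atlas M. chart_of M c)"

definition Ck_map ::
    "enat \<Rightarrow> ('p, 'd::banach) manifold \<Rightarrow> ('q, 'e::banach) manifold \<Rightarrow> ('p \<Rightarrow> 'q) \<Rightarrow> bool" where
  "Ck_map k M N f \<longleftrightarrow>
     continuous_map (mtop M) (mtop N) f \<and>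
     (\<forall>c\<in>atlas M. \<forall>d\<in>atlas N.
        Ck_on k (cmodel c) (cmap c ` {p \<in> cdom c. f p \<in> cdom d}) (cmap d \<circ> f \<circ> cinv c))"

abbreviation smooth_map ::
    "('p, 'd::banach) manifold \<Rightarrow> ('q, 'e::banach) manifold \<Rightarrow> ('p \<Rightarrow> 'q) \<Rightarrow> bool" where
  "smooth_map \<equiv> Ck_map \<infinity>"

definition prod_chart :: "('p, 'd) chart \<Rightarrow> ('q, 'e) chart \<Rightarrow> ('p \<times> 'q, 'd \<times> 'e) chart" where
  "prod_chart c d =
     \<lparr>cdom = cdom c \<times> cdom d, cmodel = cmodel c \<times> cmodel d, cmap = map_prod (cmap c) (cmap d)\<rparr>"

definition prod_manifold ::
    "('p, 'd) manifold \<Rightarrow> ('q, 'e) manifold \<Rightarrow> ('p \<times> 'q, 'd \<times> 'e) manifold" where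
  "prod_manifold M N =
     \<lparr>mtop = prod_topology (mtop M) (mtop N),
      atlas = {prod_chart c d | c d. c \<in> atlas M \<and> d \<in> atlas N}\<rparr>"

section \<open>Tangent spaces and tangent maps\<close>

text \<open>A tangent vector at \<open>q\<close> is an equivalence class of pairs (chart around \<open>q\<close>, vector of its
  model space); \<open>(c, v)\<close> and \<open>(d, w)\<close> are equivalent if the derivative of the change of charts at
  \<open>q\<close> maps \<open>v\<close> to \<open>w\<close>.\<close>

type_synonym ('q, 'e) tangent = "(('q, 'e) chart \<times> 'e) set"

definition local_deriv ::
    "('p, 'd::banach) chart \<Rightarrow> ('q, 'e::banach) chart \<Rightarrow> ('p \<Rightarrow> 'q) \<Rightarrow> 'p \<Rightarrow> 'd \<Rightarrow> 'e" where
  "local_deriv c d f p =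
     frechet_derivative (cmap d \<circ> f \<circ> cinv c)
       (at (cmap c p) within cmap c ` {p' \<in> cdom c. f p' \<in> cdom d})"

definition tangent_vec ::
    "('q, 'e::banach) manifold \<Rightarrow> 'q \<Rightarrow> ('q, 'e) chart \<Rightarrow> 'e \<Rightarrow> ('q, 'e) tangent" where
  "tangent_vec M q c v =
     {(d, w). d \<in> atlas M \<and> q \<in> cdom d \<and> w = local_deriv c d (\<lambda>p. p) q v}"

definition tangent_space ::
    "('q, 'e::banach) manifold \<Rightarrow> 'q \<Rightarrow> ('q, 'e) tangent set" where
  "tangent_space M q =
     {tangent_vec M q c v | c v. c \<in> atlas M \<and> q \<in> cdom c \<and> v \<in> cmodel c}"

text \<open>\<open>tangent_coord c\<close> is the tangent map of the chart \<open>c\<close>, from the tangent space at a point of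
  \<open>cdom c\<close> to \<open>cmodel c\<close>.\<close>

definition tangent_coord :: "('q, 'e) chart \<Rightarrow> ('q, 'e) tangent \<Rightarrow> 'e" where
  "tangent_coord c t = (THE v. (c, v) \<in> t)"

text \<open>The topology making the maps \<open>tangent_coord c\<close> (linear) homeomorphisms.\<close>

definition tangent_topology ::
    "('q, 'e::banach) manifold \<Rightarrow> 'q \<Rightarrow> ('q, 'e) tangent topology" where
  "tangent_topology M q = topology_generated_by
     {{t \<in> tangent_space M q. tangent_coord c t \<in> W} | c W. c \<in> atlas M \<and> q \<in> cdom c \<and> open W}"

definition tangent_map ::
    "('p, 'd::banach) manifold \<Rightarrow> ('q, 'e::banach) manifold \<Rightarrow> ('p \<Rightarrow> 'q) \<Rightarrow> 'p \<Rightarrow>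
     ('p, 'd) tangent \<Rightarrow> ('q, 'e) tangent" where
  "tangent_map M N f p t =
     {(d, w). d \<in> atlas N \<and> f p \<in> cdom d \<and> (\<exists>(c, v)\<in>t. w = local_deriv c d f p v)}"

text \<open>\<open>\<psi>\<close> is a chart of \<open>M\<close> with domain \<open>U\<close> around \<open>q\<close> taking values in the tangent space at \<open>q\<close>;
  the latter is a Banach space through any of the linear isomorphisms \<open>tangent_coord c\<close>.\<close>

definition tangent_chart ::
    "('q, 'e::banach) manifold \<Rightarrow> 'q \<Rightarrow> 'q set \<Rightarrow> ('q \<Rightarrow> ('q, 'e) tangent) \<Rightarrow> bool" where
  "tangent_chart M q U \<psi> \<longleftrightarrow>
     q \<in> U \<and> \<psi> ` U \<subseteq> tangent_space M q \<and>
     (\<forall>c\<in>atlas M. q \<in> cdom c \<longrightarrow>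
        chart_of M \<lparr>cdom = U, cmodel = cmodel c, cmap = tangent_coord c \<circ> \<psi>\<rparr>)"

section \<open>Chains of Banach manifolds and weak Riemannian metrics\<close>

text \<open>
  The inclusions \<open>Q r \<rightarrow> Q s\<close> are literal inclusions of point sets, i.e. the maps \<open>\<lambda>q. q\<close>.

  A chain comes with a distinguished atlas of tangent-space valued charts: \<open>K s q\<close> is the set of the
  distinguished charts \<open>(U, \<psi>)\<close> of \<open>Q s\<close> at \<open>q\<close>.  The restriction property is required for these
  charts.  It must not be forced upon all charts of the maximal atlas, as a general smooth
  diffeomorphism of an open subset of \<open>Q s\<close> does not preserve \<open>Q r\<close>; the case in which \<open>K s q\<close>
  consists of all tangent-space valued charts at \<open>q\<close> is included.  That \<open>\<psi>\<close> restricted to \<open>U \<inter> Q r\<close>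
  takes values in the tangent space of \<open>Q r\<close> means that it factors through the tangent map of the
  inclusion; the factor is \<open>\<psi>'\<close>.
\<close>

definition banach_manifold_chain ::
    "real \<Rightarrow> (real \<Rightarrow> ('q, 'e::banach) manifold) \<Rightarrow>
     (real \<Rightarrow> 'q \<Rightarrow> ('q set \<times> ('q \<Rightarrow> ('q, 'e) tangent)) set) \<Rightarrow> bool" where
  "banach_manifold_chain s0 Q K \<longleftrightarrow>
     (\<forall>s>s0. banach_manifold (Q s) \<and>
        (\<forall>q\<in>points (Q s). \<forall>(U, \<psi>)\<in>K s q. tangent_chart (Q s) q U \<psi>) \<and>
        (\<Union>q\<in>points (Q s). \<Union>(U, \<psi>)\<in>K s q. U) = points (Q s)) \<and>
     (\<forall>s>s0. \<forall>r>s.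
        points (Q r) \<subseteq> points (Q s) \<and>
        smooth_map (Q r) (Q s) (\<lambda>q. q) \<and>
        mtop (Q s) closure_of points (Q r) = points (Q s) \<and>
        (\<forall>q\<in>points (Q r).
           tangent_topology (Q s) q closure_of
             (tangent_map (Q r) (Q s) (\<lambda>q. q) q ` tangent_space (Q r) q) = tangent_space (Q s) q) \<and>
        (\<forall>q\<in>points (Q r). \<forall>(U, \<psi>)\<in>K s q. \<exists>\<psi>'.
           tangent_chart (Q r) q (U \<inter> points (Q r)) \<psi>' \<and>
           (\<forall>p\<in>U \<inter> points (Q r). \<psi> p = tangent_map (Q r) (Q s) (\<lambda>q. q) q (\<psi>' p))))"

text \<open>In each chart \<open>c\<close>, the metric is a smooth map \<open>B\<close> into the bounded bilinear forms (extended to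
  the ambient Banach space).  The metric is weak: it need not induce the topology of the tangent
  spaces.\<close>

definition weak_riemannian_metric ::
    "('q, 'e::banach) manifold \<Rightarrow> ('q \<Rightarrow> ('q, 'e) tangent \<Rightarrow> ('q, 'e) tangent \<Rightarrow> real) \<Rightarrow> bool" where
  "weak_riemannian_metric M \<gamma> \<longleftrightarrow>
     (\<forall>c\<in>atlas M. \<exists>B :: 'e \<Rightarrow> 'e \<Rightarrow>\<^sub>L 'e \<Rightarrow>\<^sub>L real.
        Ck_on \<infinity> (cmodel c) (cmap c ` cdom c) B \<and>
        (\<forall>q\<in>cdom c. \<forall>v\<in>cmodel c. \<forall>w\<in>cmodel c.
           \<gamma> q (tangent_vec M q c v) (tangent_vec M q c w) = blinfun_apply (blinfun_apply (B (cmap c q)) v) w)) \<and>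
     (\<forall>q\<in>points M. \<forall>t\<in>tangent_space M q. \<forall>u\<in>tangent_space M q. \<gamma> q t u = \<gamma> q u t) \<and>
     (\<forall>c\<in>atlas M. \<forall>q\<in>cdom c. \<forall>v\<in>cmodel c. v \<noteq> 0 \<longrightarrow>
        \<gamma> q (tangent_vec M q c v) (tangent_vec M q c v) > 0)"

definition compatible_weak_metric ::
    "real \<Rightarrow> (real \<Rightarrow> ('q, 'e::banach) manifold) \<Rightarrow>
     (real \<Rightarrow> 'q \<Rightarrow> ('q, 'e) tangent \<Rightarrow> ('q, 'e) tangent \<Rightarrow> real) \<Rightarrow> bool" where
  "compatible_weak_metric s0 Q \<gamma> \<longleftrightarrow>
     (\<forall>s>s0. weak_riemannian_metric (Q s) (\<gamma> s)) \<and>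
     (\<forall>s>s0. \<forall>r>s. \<forall>q\<in>points (Q r). \<forall>t\<in>tangent_space (Q r) q. \<forall>u\<in>tangent_space (Q r) q.
        \<gamma> s q (tangent_map (Q r) (Q s) (\<lambda>q. q) q t) (tangent_map (Q r) (Q s) (\<lambda>q. q) q u)
          = \<gamma> r q t u)"

section \<open>Lie groups and their actions on chains\<close>

text \<open>Finite dimensionality is expressed by the type of the ambient model space; the model space of
  a chart may be any subspace of it, so that dimension 0 is included.\<close>

definition lie_group ::
    "('g, 'm) monoid_scheme \<Rightarrow> ('g, 'h::euclidean_space) manifold \<Rightarrow> bool" where
  "lie_group G M \<longleftrightarrow>
     group G \<and> banach_manifold M \<and> points M = carrier G \<and>
     smooth_map (prod_manifold M M) M (\<lambda>(g, h). g \<otimes>\<^bsub>G\<^esub> h) \<and>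
     smooth_map M M (\<lambda>g. inv\<^bsub>G\<^esub> g)"

definition proper_action ::
    "'g topology \<Rightarrow> 'q topology \<Rightarrow> ('g \<Rightarrow> 'q \<Rightarrow> 'q) \<Rightarrow> bool" where
  "proper_action X Y \<Phi> \<longleftrightarrow>
     (\<forall>(g :: nat \<Rightarrow> 'g) (q :: nat \<Rightarrow> 'q).
        range g \<subseteq> topspace X \<and> range q \<subseteq> topspace Y \<and>
        (\<exists>a. limitin Y q a sequentially) \<and>
        (\<exists>b. limitin Y (\<lambda>n. \<Phi> (g n) (q n)) b sequentially) \<longrightarrow>
        (\<exists>\<sigma> l. strict_mono \<sigma> \<and> limitin X (g \<circ> \<sigma>) l sequentially))"

text \<open>\<open>\<Phi> s g\<close> is the action of \<open>g\<close> on \<open>Q s\<close>; following \<open>group_action\<close> it is extensional, i.e.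
  \<open>undefined\<close> outside \<open>Q s\<close>.\<close>

definition chain_action ::
    "('g, 'm) monoid_scheme \<Rightarrow> ('g, 'h::euclidean_space) manifold \<Rightarrow>
     real \<Rightarrow> (real \<Rightarrow> ('q, 'e::banach) manifold) \<Rightarrow> (real \<Rightarrow> 'g \<Rightarrow> 'q \<Rightarrow> 'q) \<Rightarrow> bool" where
  "chain_action G M s0 Q \<Phi> \<longleftrightarrow>
     (\<forall>s>s0. group_action G (points (Q s)) (\<Phi> s) \<and>
        continuous_map (prod_topology (mtop M) (mtop (Q s))) (mtop (Q s)) (\<lambda>(g, q). \<Phi> s g q) \<and>
        proper_action (mtop M) (mtop (Q s)) (\<Phi> s) \<and>
        (\<forall>g\<in>carrier G. smooth_map (Q s) (Q s) (\<Phi> s g))) \<and>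
     (\<forall>s>s0. \<forall>r>s. \<forall>g\<in>carrier G. \<forall>q\<in>points (Q r). \<Phi> s g q = \<Phi> r g q) \<and>
     (\<forall>s>s0 + 1. \<forall>q\<in>points (Q s). Ck_map 1 M (Q (s - 1)) (\<lambda>g. \<Phi> s g q))"

definition isotropy_type_set ::
    "('g, 'm) monoid_scheme \<Rightarrow> 'q set \<Rightarrow> ('g \<Rightarrow> 'q \<Rightarrow> 'q) \<Rightarrow> 'g set \<Rightarrow> 'q set" where
  "isotropy_type_set G X \<Phi> H = {q \<in> X. stabilizer G \<Phi> q = H}"

definition fixed_point_set ::
    "('g, 'm) monoid_scheme \<Rightarrow> 'q set \<Rightarrow> ('g \<Rightarrow> 'q \<Rightarrow> 'q) \<Rightarrow> 'g set \<Rightarrow> 'q set" where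
  "fixed_point_set G X \<Phi> H = {q \<in> X. stabilizer G \<Phi> q \<supseteq> H}"

end

theory Submission
  imports Defs
begin

text \<open>
  Why isotropy cannot jump near a point \<open>q\<close> with isotropy group \<open>H\<close>, within the set of points fixed
  by \<open>H\<close>:

  The closed subgroup \<open>H\<close> is isolated from above.  There is a neighbourhood \<open>W\<close> of \<open>\<one>\<close> such that
  a subgroup \<open>K \<supseteq> H\<close> contained in the tube \<open>WH\<close> equals \<open>H\<close> (\<open>lie_group_subgroup_isolated\<close>).
  If points \<open>p n\<close> fixed by \<open>H\<close> converge to \<open>q\<close> and have isotropy groups larger than \<open>H\<close>, then there
  are \<open>g n\<close> outside the tube \<open>WH\<close> that fix \<open>p n\<close>.  By properness a subsequence of the \<open>g n\<close> has a
  limit \<open>l\<close>, by continuity \<open>l\<close> fixes \<open>q\<close>, so \<open>l \<in> H\<close>, and then the \<open>g n\<close> of the subsequence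
  enter the tube, a contradiction.  This argument is \<open>isotropy_type_set_openin\<close>.

  The isolation of \<open>H\<close> is a relative form of the fact that a Lie group has no small subgroups.
  In coordinates \<open>\<phi>\<close> vanishing at \<open>\<one>\<close> the product is addition up to an error that is small relative
  to the second factor.  Measure \<open>k \<in> K\<close> by the infimum \<open>r k\<close> of \<open>norm (\<phi> (k \<otimes> h))\<close> over
  \<open>h \<in> H\<close>, and let \<open>s\<close> be the supremum of \<open>r\<close> on \<open>K\<close>; if \<open>K \<noteq> H\<close> then \<open>s > 0\<close> since \<open>H\<close> is
  closed.  Take \<open>u \<in> K\<close> almost attaining \<open>s\<close> and almost shortest in its coset \<open>uH\<close>.  As
  \<open>u \<otimes> u \<in> K\<close>, there is \<open>h \<in> H\<close> such that \<open>w = u \<otimes> u \<otimes> h\<close> has length at most about \<open>s\<close>.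
  Up to small errors \<open>h\<close> is \<open>w - 2u\<close>.  If \<open>H\<close> contains an element \<open>h'\<close> close to \<open>h/2\<close>, then
  \<open>u \<otimes> h'\<close> is close to \<open>w/2\<close>, so it is an element of \<open>uH\<close> of length at most about \<open>s/2\<close>, which
  contradicts the choice of \<open>u\<close> (\<open>closed_subgroup_isolated\<close>).

  That \<open>H\<close> contains approximate halves of its small elements is \<open>subgroup_halving\<close>.  It replaces
  the theorem that a closed subgroup is a submanifold, and is where finite dimension enters:
  directions of a sequence in \<open>H\<close> tending to \<open>\<one>\<close> accumulate, and suitable powers of its later
  members come close to half of an earlier one.
\<close>

section \<open>Closed subgroups in coordinates where the product is approximately addition\<close>

lemma norm_diff_triangle_chain:
  fixes x y z u w :: "'a::real_normed_vector"
  shows "norm (x - w) \<le> norm (x - y) + norm (y - z) + norm (z - u) + norm (u - w)"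
  by norm

text \<open>
  The arithmetic behind \<open>closed_subgroup_isolated\<close>, with \<open>u\<close>, \<open>uu\<close>, \<open>w\<close>, \<open>h\<close>, \<open>h'\<close>, \<open>z\<close> standing for
  the coordinates of \<open>u\<close>, \<open>u \<otimes> u\<close>, \<open>u \<otimes> u \<otimes> h\<close>, \<open>h\<close>, \<open>h'\<close>, \<open>u \<otimes> h'\<close>.  Without the error terms
  \<open>z = u + h/2 = w/2\<close>; the rate \<open>1/100\<close> leaves ample room below \<open>9/10 * s\<close>.
\<close>

lemma halved_square_estimate:
  fixes u uu w h h' z :: "'a::real_normed_vector"
  assumes "norm (uu - u - u) \<le> 1/100 * norm u" "norm (w - uu - h) \<le> 1/100 * norm h"
    "norm (h' - (1/2) *\<^sub>R h) \<le> 1/100 * norm h" "norm (z - u - h') \<le> 1/100 * norm h'"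
    "norm u < 11/10 * s" "norm w < 11/10 * s"
  shows "norm z < 9/10 * s"
proof -
  define k where "k = (1/2) *\<^sub>R h"
  have h: "norm h \<le> norm (w - uu - h) + norm w + norm (uu - u - u) + norm u + norm u"
    by norm
  have k: "norm k = 1/2 * norm h"
    by (simp add: k_def)
  have h': "norm h' \<le> norm (h' - k) + norm k"
    by norm
  have "u + k = (1/2) *\<^sub>R (u + u + h)"
    by (simp add: k_def scaleR_add_right flip: scaleR_2)
  then have "norm (u + k) = 1/2 * norm (u + u + h)"
    by simp
  moreover have "norm (u + u + h) \<le> norm (w - uu - h) + norm w + norm (uu - u - u)"
    by norm
  moreover have "norm z \<le> norm (z - u - h') + norm (h' - k) + norm (u + k)"
    by norm
  ultimately show ?thesis using assms[folded k_def] h h' k norm_ge_zero[of u] by linarith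
qed

text \<open>
  Multiplication in a chart at \<open>\<one>\<close> satisfies \<open>mult_approx\<close> as soon as it is strictly differentiable
  at \<open>(\<one>, \<one>)\<close>.  The bound by \<open>\<phi> y\<close> alone, without \<open>\<phi> x\<close>, keeps the error accumulated in a power
  \<open>x [^] m\<close> below \<open>\<epsilon> * (m * norm (\<phi> x))\<close>.
\<close>

locale local_coordinates = group G for G (structure) +
  fixes D :: "'a set" and \<phi> :: "'a \<Rightarrow> 'v::euclidean_space"
  assumes D_carrier: "D \<subseteq> carrier G"
    and one_D: "\<one> \<in> D" and coord_one: "\<phi> \<one> = 0"
    and mult_approx: "0 < \<epsilon> \<Longrightarrow> \<exists>\<delta>>0. \<forall>x\<in>D. \<forall>y\<in>D. norm (\<phi> x) < \<delta> \<longrightarrow> norm (\<phi> y) < \<delta> \<longrightarrow>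
          x \<otimes> y \<in> D \<and> norm (\<phi> (x \<otimes> y) - \<phi> x - \<phi> y) \<le> \<epsilon> * norm (\<phi> y)"
    and inv_small: "0 < \<epsilon> \<Longrightarrow> \<exists>\<delta>>0. \<forall>x\<in>D. norm (\<phi> x) < \<delta> \<longrightarrow> inv x \<in> D \<and> norm (\<phi> (inv x)) < \<epsilon>"
begin

lemma power_approx:
  assumes "0 < \<epsilon>"
  shows "\<exists>\<delta>>0. \<forall>x\<in>D. \<forall>m. norm (\<phi> x) < \<delta> \<longrightarrow> real m * norm (\<phi> x) < \<delta> \<longrightarrow>
           x [^] m \<in> D \<and> norm (\<phi> (x [^] m) - real m *\<^sub>R \<phi> x) \<le> \<epsilon> * (real m * norm (\<phi> x))"
proof -
  define e where "e = min \<epsilon> 1"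
  have e: "0 < e" "e \<le> 1" "e \<le> \<epsilon>" using assms by (auto simp: e_def)
  obtain \<delta> where \<delta>: "\<delta> > 0" and mult: "\<And>x y. x \<in> D \<Longrightarrow> y \<in> D \<Longrightarrow> norm (\<phi> x) < \<delta> \<Longrightarrow> norm (\<phi> y) < \<delta> \<Longrightarrow>
          x \<otimes> y \<in> D \<and> norm (\<phi> (x \<otimes> y) - \<phi> x - \<phi> y) \<le> e * norm (\<phi> y)"
    using mult_approx[OF e(1)] by blast
  have *: "x [^] m \<in> D \<and> norm (\<phi> (x [^] m) - real m *\<^sub>R \<phi> x) \<le> e * (real m * norm (\<phi> x))"
    if x: "x \<in> D" "norm (\<phi> x) < \<delta> / 2" and "real m * norm (\<phi> x) < \<delta> / 2" for x and m :: nat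
    using that(3)
  proof (induction m)
    case 0
    then show ?case by (simp add: one_D coord_one)
  next
    case (Suc m)
    have m: "real m * norm (\<phi> x) < \<delta> / 2"
    proof -
      have "real m * norm (\<phi> x) \<le> real (Suc m) * norm (\<phi> x)" by (intro mult_right_mono) auto
      then show ?thesis using Suc.prems by linarith
    qed
    note IH = Suc.IH[OF m]
    have "e * (real m * norm (\<phi> x)) \<le> 1 * (real m * norm (\<phi> x))"
      using e by (intro mult_right_mono) auto
    moreover have "norm (\<phi> (x [^] m)) \<le> norm (real m *\<^sub>R \<phi> x) + norm (\<phi> (x [^] m) - real m *\<^sub>R \<phi> x)"
      by (rule norm_triangle_sub)
    ultimately have "norm (\<phi> (x [^] m)) < \<delta>"
      using IH m by simp
    with mult[of "x [^] m" x] IH x \<delta>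
    have step: "x [^] m \<otimes> x \<in> D"
      "norm (\<phi> (x [^] m \<otimes> x) - \<phi> (x [^] m) - \<phi> x) \<le> e * norm (\<phi> x)" by auto
    have "norm (\<phi> (x [^] m \<otimes> x) - real (Suc m) *\<^sub>R \<phi> x)
        = norm ((\<phi> (x [^] m \<otimes> x) - \<phi> (x [^] m) - \<phi> x) + (\<phi> (x [^] m) - real m *\<^sub>R \<phi> x))"
      by (simp add: algebra_simps)
    also have "\<dots> \<le> e * norm (\<phi> x) + e * (real m * norm (\<phi> x))"
      using step(2) IH by (intro norm_triangle_mono) auto
    finally show ?case using step(1) by (simp add: algebra_simps)
  qed
  show ?thesis
  proof (intro exI[of _ "\<delta>/2"] conjI ballI allI impI)
    fix x and m :: nat assume x: "x \<in> D" "norm (\<phi> x) < \<delta>/2" "real m * norm (\<phi> x) < \<delta>/2"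
    show "x [^] m \<in> D" using * x by blast
    have "e * (real m * norm (\<phi> x)) \<le> \<epsilon> * (real m * norm (\<phi> x))"
      using e by (intro mult_right_mono) auto
    then show "norm (\<phi> (x [^] m) - real m *\<^sub>R \<phi> x) \<le> \<epsilon> * (real m * norm (\<phi> x))"
      using *[OF x] by linarith
  qed (use \<delta> in auto)
qed

text \<open>
  If a sequence of elements tending to \<open>\<one>\<close> had no approximate halves, pass to a subsequence whose
  directions converge to \<open>v\<close>.  A power of a much smaller member \<open>b (\<tau> k)\<close> runs along \<open>v\<close> in short
  steps and so comes near half of \<open>b (\<tau> n)\<close>, which lies almost on the same ray.
\<close>

lemma subgroup_halving:
  assumes H: "subgroup H G" and \<eta>: "0 < \<eta>"
  shows "\<exists>\<delta>>0. \<forall>h\<in>H \<inter> D. norm (\<phi> h) < \<delta> \<longrightarrow>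
           (\<exists>h'\<in>H \<inter> D. norm (\<phi> h' - (1/2) *\<^sub>R \<phi> h) \<le> \<eta> * norm (\<phi> h))"
proof (rule ccontr)
  assume contra: "\<not> ?thesis"
  have "\<forall>n. \<exists>h. h \<in> H \<inter> D \<and> norm (\<phi> h) < inverse (real (Suc n)) \<and>
           (\<forall>h'\<in>H \<inter> D. \<not> norm (\<phi> h' - (1/2) *\<^sub>R \<phi> h) \<le> \<eta> * norm (\<phi> h))"
  proof
    fix n
    have "inverse (real (Suc n)) > 0" by simp
    with contra show "\<exists>h. h \<in> H \<inter> D \<and> norm (\<phi> h) < inverse (real (Suc n)) \<and>
           (\<forall>h'\<in>H \<inter> D. \<not> norm (\<phi> h' - (1/2) *\<^sub>R \<phi> h) \<le> \<eta> * norm (\<phi> h))"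
      by meson
  qed
  from choice[OF this] obtain b where b: "\<And>n. b n \<in> H \<inter> D"
      "\<And>n. norm (\<phi> (b n)) < inverse (real (Suc n))"
    and bad: "\<And>n h'. h' \<in> H \<inter> D \<Longrightarrow> \<not> norm (\<phi> h' - (1/2) *\<^sub>R \<phi> (b n)) \<le> \<eta> * norm (\<phi> (b n))"
    by blast
  have b_nz: "\<phi> (b n) \<noteq> 0" for n
    using bad[of \<one> n] one_D coord_one subgroup.one_closed[OF H] by auto
  have "\<forall>n. \<phi> (b n) /\<^sub>R norm (\<phi> (b n)) \<in> sphere 0 1"
    using b_nz by simp
  then obtain v \<tau> where v: "norm v = 1" and \<tau>: "strict_mono \<tau>"
    and lim: "((\<lambda>n. \<phi> (b n) /\<^sub>R norm (\<phi> (b n))) \<circ> \<tau>) \<longlonglongrightarrow> v"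
    using compact_sphere[of "0::'v" 1] unfolding compact_def by (meson mem_sphere_0)
  define t where "t n = norm (\<phi> (b (\<tau> n)))" for n
  have t_pos: "t n > 0" for n using b_nz by (simp add: t_def)
  have "(\<lambda>n. norm (\<phi> (b n))) \<longlonglongrightarrow> 0"
    by (rule tendsto_sandwich[OF _ _ tendsto_const LIMSEQ_inverse_real_of_nat])
       (use b(2) in \<open>auto intro!: eventuallyI less_imp_le\<close>)
  then have t_lim: "t \<longlonglongrightarrow> 0"
    unfolding t_def[abs_def] by (auto simp: o_def dest: LIMSEQ_subseq_LIMSEQ[OF _ \<tau>])
  have dir: "\<forall>\<^sub>F n in sequentially. norm (\<phi> (b (\<tau> n)) - t n *\<^sub>R v) < t n * (\<eta>/4)"
  proof -
    have "\<forall>\<^sub>F n in sequentially. dist (\<phi> (b (\<tau> n)) /\<^sub>R t n) v < \<eta>/4"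
      using tendstoD[OF lim, of "\<eta>/4"] \<eta> by (simp add: o_def t_def)
    then show ?thesis
    proof eventually_elim
      case (elim n)
      have "\<phi> (b (\<tau> n)) - t n *\<^sub>R v = t n *\<^sub>R (\<phi> (b (\<tau> n)) /\<^sub>R t n - v)"
        using t_pos[of n] by (simp add: algebra_simps)
      then show ?case
        using elim t_pos[of n] by (simp add: dist_norm)
    qed
  qed
  obtain \<delta> where \<delta>: "\<delta> > 0" and pow: "\<And>x m. x \<in> D \<Longrightarrow> norm (\<phi> x) < \<delta> \<Longrightarrow> real m * norm (\<phi> x) < \<delta> \<Longrightarrow>
           x [^] m \<in> D \<and> norm (\<phi> (x [^] m) - real m *\<^sub>R \<phi> x) \<le> (\<eta>/4) * (real m * norm (\<phi> x))"
    using power_approx[of "\<eta>/4"] \<eta> by auto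
  have small: "\<forall>\<^sub>F n in sequentially. t n < d" if "d > 0" for d
    using order_tendstoD(2)[OF t_lim that] .
  obtain n where n: "t n < \<delta>" "norm (\<phi> (b (\<tau> n)) - t n *\<^sub>R v) < t n * (\<eta>/4)"
    using eventually_happens[OF eventually_conj[OF small[OF \<delta>] dir]] by auto
  have "t n * (\<eta>/4) > 0" using t_pos \<eta> by simp
  from eventually_happens[OF eventually_conj[OF small[OF \<delta>] eventually_conj[OF small[OF this] dir]]]
  obtain k where k: "t k < \<delta>" "t k < t n * (\<eta>/4)" "norm (\<phi> (b (\<tau> k)) - t k *\<^sub>R v) < t k * (\<eta>/4)"
    by auto
  \<comment> \<open>the number of steps of length \<open>t k\<close> that fit into half the length of \<open>b (\<tau> n)\<close>\<close>
  define m where "m = nat \<lfloor>t n / (2 * t k)\<rfloor>"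
  have "real m \<le> t n / (2 * t k)" "t n / (2 * t k) < real m + 1"
    using t_pos[of n] t_pos[of k] by (auto simp: m_def)
  then have m: "real m * t k \<le> t n / 2" "t n / 2 < real m * t k + t k"
    using t_pos[of k] by (auto simp: field_simps)
  define h' where "h' = b (\<tau> k) [^] m"
  have bH: "b (\<tau> k) \<in> H" "b (\<tau> k) \<in> D" using b(1) by auto
  have "real m * norm (\<phi> (b (\<tau> k))) < \<delta>"
    unfolding t_def[symmetric] using m(1) n(1) t_pos[of n] by linarith
  with pow[OF bH(2), of m] k(1)
  have h': "h' \<in> D" "norm (\<phi> h' - real m *\<^sub>R \<phi> (b (\<tau> k))) \<le> (\<eta>/4) * (real m * t k)"
    by (auto simp: h'_def t_def)
  have "h' \<in> H"
    unfolding h'_def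
    by (induction m) (use bH(1) in \<open>auto simp: subgroup.one_closed[OF H] subgroup.m_closed[OF H]\<close>)
  \<comment> \<open>from \<open>h'\<close> to half of \<open>b (\<tau> n)\<close>, via \<open>m\<close> times \<open>b (\<tau> k)\<close> and the ray spanned by \<open>v\<close>\<close>
  have mt: "(\<eta>/4) * (real m * t k) \<le> (\<eta>/4) * (t n / 2)"
    using m(1) \<eta> by (intro mult_left_mono) auto
  have e1: "norm (\<phi> h' - real m *\<^sub>R \<phi> (b (\<tau> k))) \<le> (\<eta>/8) * t n"
    using h'(2) mt by simp
  have "norm (real m *\<^sub>R \<phi> (b (\<tau> k)) - (real m * t k) *\<^sub>R v)
      = real m * norm (\<phi> (b (\<tau> k)) - t k *\<^sub>R v)"
    by (simp flip: scaleR_scaleR scaleR_diff_right)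
  also have "\<dots> \<le> real m * (t k * (\<eta>/4))"
    using k(3) by (intro mult_left_mono) auto
  finally have e2: "norm (real m *\<^sub>R \<phi> (b (\<tau> k)) - (real m * t k) *\<^sub>R v) \<le> (\<eta>/8) * t n"
    using mt by (simp add: mult_ac)
  have "norm ((real m * t k) *\<^sub>R v - (t n / 2) *\<^sub>R v) = \<bar>real m * t k - t n / 2\<bar>"
    using v by (simp flip: scaleR_diff_left)
  then have e3: "norm ((real m * t k) *\<^sub>R v - (t n / 2) *\<^sub>R v) \<le> (\<eta>/4) * t n"
    using m k(2) by (simp add: mult_ac)
  have "(t n / 2) *\<^sub>R v - (1/2) *\<^sub>R \<phi> (b (\<tau> n)) = (1/2) *\<^sub>R (t n *\<^sub>R v - \<phi> (b (\<tau> n)))"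
    by (simp add: scaleR_diff_right)
  then have "norm ((t n / 2) *\<^sub>R v - (1/2) *\<^sub>R \<phi> (b (\<tau> n))) = 1/2 * norm (\<phi> (b (\<tau> n)) - t n *\<^sub>R v)"
    by (simp add: norm_minus_commute)
  then have e4: "norm ((t n / 2) *\<^sub>R v - (1/2) *\<^sub>R \<phi> (b (\<tau> n))) \<le> (\<eta>/8) * t n"
    using n(2) by (simp add: mult_ac)
  have "norm (\<phi> h' - (1/2) *\<^sub>R \<phi> (b (\<tau> n))) \<le>
     norm (\<phi> h' - real m *\<^sub>R \<phi> (b (\<tau> k))) + norm (real m *\<^sub>R \<phi> (b (\<tau> k)) - (real m * t k) *\<^sub>R v)
     + norm ((real m * t k) *\<^sub>R v - (t n / 2) *\<^sub>R v) + norm ((t n / 2) *\<^sub>R v - (1/2) *\<^sub>R \<phi> (b (\<tau> n)))"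
    by (rule norm_diff_triangle_chain)
  also have "\<dots> \<le> \<eta> * t n"
    using e1 e2 e3 e4 \<open>t n * (\<eta>/4) > 0\<close> by (simp add: mult_ac)
  finally show False
    using bad[of h' "\<tau> n"] \<open>h' \<in> H\<close> h'(1) by (simp add: t_def)
qed

definition coord_ball :: "real \<Rightarrow> 'a set" where
  "coord_ball \<delta> = {x \<in> D. norm (\<phi> x) < \<delta>}"

text \<open>
  The assumption \<open>closed\<close> is closedness of \<open>H\<close>: elements \<open>h \<in> H\<close> with \<open>x \<otimes> h\<close> close to \<open>\<one>\<close> approximate
  \<open>inv x\<close>.  The condition on \<open>K\<close> says that \<open>K\<close> lies in the tube of radius \<open>\<delta>\<close> around \<open>H\<close>.  An element
  of \<open>K\<close> almost farthest from \<open>H\<close> cannot exist: its square would be farther still, unless an element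
  of \<open>H\<close> brings the square back, and then an approximate half of that element brings the
  original element closer to \<open>\<one>\<close>.
\<close>

lemma closed_subgroup_isolated:
  assumes H: "subgroup H G"
    and closed: "\<And>x. x \<in> carrier G \<Longrightarrow> (\<And>\<delta>. \<delta> > 0 \<Longrightarrow> \<exists>h\<in>H. x \<otimes> h \<in> coord_ball \<delta>) \<Longrightarrow> x \<in> H"
  shows "\<exists>\<delta>>0. \<forall>K. subgroup K G \<longrightarrow> H \<subseteq> K \<longrightarrow> (\<forall>k\<in>K. \<exists>h\<in>H. k \<otimes> h \<in> coord_ball \<delta>) \<longrightarrow> K = H"
proof -
  obtain \<alpha> where \<alpha>: "\<alpha> > 0" and mult: "\<And>x y. x \<in> D \<Longrightarrow> y \<in> D \<Longrightarrow> norm (\<phi> x) < \<alpha> \<Longrightarrow> norm (\<phi> y) < \<alpha> \<Longrightarrow>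
          x \<otimes> y \<in> D \<and> norm (\<phi> (x \<otimes> y) - \<phi> x - \<phi> y) \<le> 1/100 * norm (\<phi> y)"
    using mult_approx[of "1/100"] by auto
  obtain \<rho> where \<rho>: "\<rho> > 0" and halve: "\<And>h. h \<in> H \<Longrightarrow> h \<in> D \<Longrightarrow> norm (\<phi> h) < \<rho> \<Longrightarrow>
           (\<exists>h'\<in>H \<inter> D. norm (\<phi> h' - (1/2) *\<^sub>R \<phi> h) \<le> 1/100 * norm (\<phi> h))"
    using subgroup_halving[OF H, of "1/100"] by auto
  define \<beta> where "\<beta> = min \<alpha> \<rho>"
  have \<beta>: "\<beta> > 0" "\<beta> \<le> \<alpha>" "\<beta> \<le> \<rho>" using \<alpha> \<rho> by (auto simp: \<beta>_def)
  obtain \<iota> where \<iota>: "\<iota> > 0" and inv_ball: "\<And>x. x \<in> D \<Longrightarrow> norm (\<phi> x) < \<iota> \<Longrightarrow> inv x \<in> D \<and> norm (\<phi> (inv x)) < \<beta>/4"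
    using inv_small[of "\<beta>/4"] \<beta> by auto
  define \<delta> where "\<delta> = min (\<beta>/10) (\<iota>/10)"
  have \<delta>: "\<delta> > 0" "\<delta> \<le> \<beta>/10" "\<delta> \<le> \<iota>/10" using \<beta> \<iota> by (auto simp: \<delta>_def)
  have "K \<subseteq> H" if K: "subgroup K G" "H \<subseteq> K" and near: "\<forall>k\<in>K. \<exists>h\<in>H. k \<otimes> h \<in> coord_ball \<delta>" for K
  proof (rule ccontr)
    assume "\<not> K \<subseteq> H"
    then obtain k1 where k1: "k1 \<in> K" "k1 \<notin> H" by auto
    have Kc: "K \<subseteq> carrier G" using subgroup.subset[OF K(1)] .
    have Hc: "H \<subseteq> carrier G" using subgroup.subset[OF H] .
    define r where "r k = (INF h\<in>{h\<in>H. k \<otimes> h \<in> D}. norm (\<phi> (k \<otimes> h)))" for k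
    have r_le: "r k \<le> norm (\<phi> (k \<otimes> h))" if "h \<in> H" "k \<otimes> h \<in> D" for k h
      unfolding r_def using that by (intro cINF_lower bdd_belowI2[of _ 0]) auto
    have r_less: "\<exists>h\<in>H. k \<otimes> h \<in> D \<and> norm (\<phi> (k \<otimes> h)) < t" if "k \<in> K" "r k < t" for k t
    proof -
      have "{h\<in>H. k \<otimes> h \<in> D} \<noteq> {}" using near that(1) by (auto simp: coord_ball_def)
      then show ?thesis
        using that(2) unfolding r_def by (subst (asm) cINF_less_iff) (auto intro!: bdd_belowI2[of _ 0])
    qed
    have r_\<delta>: "r k \<le> \<delta>" if "k \<in> K" for k
      using near that r_le by (fastforce simp: coord_ball_def)
    define s where "s = (SUP k\<in>K. r k)"
    have bdd: "bdd_above (r ` K)" using r_\<delta> by (intro bdd_aboveI2)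
    have r_s: "r k \<le> s" if "k \<in> K" for k
      unfolding s_def using bdd that by (intro cSUP_upper)
    have "s \<le> \<delta>" unfolding s_def using k1 r_\<delta> by (intro cSUP_least) auto
    have "r k1 > 0"
    proof (rule ccontr)
      assume "\<not> r k1 > 0"
      then have "\<exists>h\<in>H. k1 \<otimes> h \<in> coord_ball d" if "d > 0" for d
        using r_less[OF k1(1), of d] that by (auto simp: coord_ball_def)
      then show False using closed[of k1] k1 Kc by auto
    qed
    then have s: "s > 0" using r_s[OF k1(1)] by linarith
    then have "9/10 * s < (SUP k\<in>K. r k)" by (simp add: s_def[symmetric])
    then obtain k0 where k0: "k0 \<in> K" "9/10 * s < r k0"
      using k1(1) bdd by (subst (asm) less_cSUP_iff) auto
    have "r k0 < 11/10 * s" using r_s[OF k0(1)] s by simp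
    then obtain h0 where h0: "h0 \<in> H" "k0 \<otimes> h0 \<in> D" "norm (\<phi> (k0 \<otimes> h0)) < 11/10 * s"
      using r_less[OF k0(1)] by blast
    define u where "u = k0 \<otimes> h0"
    have u: "u \<in> D" "norm (\<phi> u) < 11/10 * s" "u \<in> K"
      using h0 k0 K by (auto simp: u_def subgroup.m_closed)
    have uu: "u \<otimes> u \<in> D" "norm (\<phi> (u \<otimes> u) - \<phi> u - \<phi> u) \<le> 1/100 * norm (\<phi> u)" "u \<otimes> u \<in> K"
      using mult[OF u(1) u(1)] u \<open>s \<le> \<delta>\<close> \<delta> \<beta> s subgroup.m_closed[OF K(1)] by auto
    have "norm (\<phi> (u \<otimes> u)) \<le> norm (\<phi> (u \<otimes> u) - \<phi> u - \<phi> u) + norm (\<phi> u) + norm (\<phi> u)"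
      by norm
    then have uu_small: "norm (\<phi> (u \<otimes> u)) < 3 * s"
      using uu(2) u(2) s by linarith
    have "r (u \<otimes> u) < 11/10 * s" using r_s[OF uu(3)] s by simp
    then obtain h where h: "h \<in> H" "u \<otimes> u \<otimes> h \<in> D" "norm (\<phi> (u \<otimes> u \<otimes> h)) < 11/10 * s"
      using r_less[OF uu(3)] by blast
    \<comment> \<open>to apply the product estimate to \<open>u \<otimes> u\<close> and \<open>h\<close>, first locate \<open>h\<close> in the chart near \<open>\<one>\<close>\<close>
    have inv_uu: "inv (u \<otimes> u) \<in> D" "norm (\<phi> (inv (u \<otimes> u))) < \<beta>/4"
      using inv_ball[OF uu(1)] uu_small \<open>s \<le> \<delta>\<close> \<delta> s by auto
    have carr: "u \<in> carrier G" "h \<in> carrier G" using u h Kc Hc by auto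
    have h_eq: "inv (u \<otimes> u) \<otimes> (u \<otimes> u \<otimes> h) = h"
      using carr m_assoc[of "inv (u \<otimes> u)" "u \<otimes> u" h] by simp
    have h_D: "h \<in> D" "norm (\<phi> h - \<phi> (inv (u \<otimes> u)) - \<phi> (u \<otimes> u \<otimes> h)) \<le> 1/100 * norm (\<phi> (u \<otimes> u \<otimes> h))"
      using mult[OF inv_uu(1) h(2)] h(3) inv_uu(2) \<open>s \<le> \<delta>\<close> \<delta> \<beta> s unfolding h_eq by auto
    have "norm (\<phi> h) \<le> norm (\<phi> h - \<phi> (inv (u \<otimes> u)) - \<phi> (u \<otimes> u \<otimes> h)) + norm (\<phi> (inv (u \<otimes> u)))
        + norm (\<phi> (u \<otimes> u \<otimes> h))"
      by norm
    then have h_small: "norm (\<phi> h) < \<beta>/2"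
      using h_D(2) h(3) inv_uu(2) \<open>s \<le> \<delta>\<close> \<delta> s by linarith
    have w: "norm (\<phi> (u \<otimes> u \<otimes> h) - \<phi> (u \<otimes> u) - \<phi> h) \<le> 1/100 * norm (\<phi> h)"
      using mult[OF uu(1) h_D(1)] uu_small h_small \<open>s \<le> \<delta>\<close> \<delta> \<beta> s by auto
    obtain h' where h': "h' \<in> H" "h' \<in> D" "norm (\<phi> h' - (1/2) *\<^sub>R \<phi> h) \<le> 1/100 * norm (\<phi> h)"
      using halve[OF h(1) h_D(1)] h_small \<beta> by auto
    have "norm (\<phi> h') \<le> norm (\<phi> h' - (1/2) *\<^sub>R \<phi> h) + 1/2 * norm (\<phi> h)"
      using norm_triangle_ineq[of "\<phi> h' - (1/2) *\<^sub>R \<phi> h" "(1/2) *\<^sub>R \<phi> h"] by simp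
    then have "norm (\<phi> h') < \<alpha>"
      using h'(3) h_small \<beta> by linarith
    then have uh': "u \<otimes> h' \<in> D" "norm (\<phi> (u \<otimes> h') - \<phi> u - \<phi> h') \<le> 1/100 * norm (\<phi> h')"
      using mult[OF u(1) h'(2)] u(2) \<open>s \<le> \<delta>\<close> \<delta> \<beta> s by auto
    \<comment> \<open>an element of the coset of \<open>k0\<close> that is shorter than \<open>r k0\<close>\<close>
    have "norm (\<phi> (u \<otimes> h')) < 9/10 * s"
      by (rule halved_square_estimate[OF uu(2) w h'(3) uh'(2) u(2) h(3)])
    moreover have "u \<otimes> h' = k0 \<otimes> (h0 \<otimes> h')"
      unfolding u_def using k0(1) h0(1) h'(1) Kc Hc by (intro m_assoc) auto
    ultimately show False
      using r_le[of "h0 \<otimes> h'" k0] uh'(1) k0(2) subgroup.m_closed[OF H h0(1) h'(1)] by auto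
  qed
  then show ?thesis using \<delta>(1) by blast
qed

end

section \<open>Strict differentiability and charts\<close>

text \<open>
  The mean value inequality on the segment from \<open>x\<close> to \<open>y\<close>, applied to \<open>f\<close> minus its derivative at
  \<open>x0\<close>.  Restricting to segments turns the Frechet derivative relative to \<open>E\<close>, which says nothing about
  directions off \<open>E\<close>, into an ordinary derivative of a function of one real variable.  As \<open>A\<close> does not
  depend on \<open>x\<close>, the estimate compares the changes of \<open>f\<close> along two parallel segments.
\<close>

lemma Ck_on_strict_derivative:
  assumes Ck: "Ck_on k E S f" "1 \<le> k" and C: "C \<subseteq> S" "openin (top_of_set E) C" "x0 \<in> C"
    and E: "subspace E"
  obtains A where "\<And>\<epsilon>. 0 < \<epsilon> \<Longrightarrow> \<exists>\<delta>>0. \<forall>x\<in>E. \<forall>y\<in>E. dist x x0 < \<delta> \<longrightarrow> dist y x0 < \<delta> \<longrightarrow>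
      x \<in> C \<and> norm (f y - f x - A (y - x)) \<le> \<epsilon> * norm (y - x)"
proof -
  from Ck(1) obtain D where D0: "\<forall>x\<in>S. D 0 x [] = f x"
    and D1: "\<forall>n. enat n \<le> k \<longrightarrow>
           (\<forall>x\<in>S. multilinear_on n E (D n x) \<and> (\<exists>B. norm_le_on n E (D n x) B) \<and>
              (\<forall>\<epsilon>>0. \<forall>\<^sub>F y in at x within S. norm_le_on n E (\<lambda>vs. D n y vs - D n x vs) \<epsilon>))"
    and D2: "\<forall>n. enat n < k \<longrightarrow>
           (\<forall>x\<in>S. \<forall>\<epsilon>>0. \<forall>\<^sub>F y in at x within S.
              norm_le_on n E (\<lambda>vs. D n y vs - D n x vs - D (Suc n) x ((y - x) # vs))
                (\<epsilon> * norm (y - x)))"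
    unfolding Ck_on_def by blast
  define A where "A x v = D 1 x [v]" for x v
  have k: "enat 1 \<le> k" "enat 0 < k"
    using Ck(2) by (auto simp: one_enat_def intro: less_le_trans[of _ "enat 1"])
  have A_scale: "A x (a *\<^sub>R v) = a *\<^sub>R A x v" if "x \<in> S" "v \<in> E" for x a v
  proof -
    have "multilinear_on 1 E (D 1 x)" using D1 k(1) that(1) by blast
    then have "D 1 x ([] @ (a *\<^sub>R v + 0 *\<^sub>R v) # []) = a *\<^sub>R D 1 x ([] @ v # []) + 0 *\<^sub>R D 1 x ([] @ v # [])"
      unfolding multilinear_on_def using that(2)
      by (metis One_nat_def add.commute add_0 empty_subsetI list.set(1) list.size(3) plus_1_eq_Suc)
    then show ?thesis by (simp add: A_def)
  qed
  have deriv: "\<exists>d>0. \<forall>y\<in>S. dist y x < d \<longrightarrow> norm (f y - f x - A x (y - x)) \<le> e * norm (y - x)"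
    if "x \<in> S" "e > 0" for x e
  proof -
    have "\<forall>\<^sub>F y in at x within S. norm_le_on 0 E (\<lambda>vs. D 0 y vs - D 0 x vs - D (Suc 0) x ((y - x) # vs))
                (e * norm (y - x))"
      using D2 k(2) that by blast
    then obtain d where d: "d > 0" "\<forall>y\<in>S. y \<noteq> x \<and> dist y x < d \<longrightarrow>
        norm_le_on 0 E (\<lambda>vs. D 0 y vs - D 0 x vs - D (Suc 0) x ((y - x) # vs)) (e * norm (y - x))"
      unfolding eventually_at by blast
    have "norm (f y - f x - A x (y - x)) \<le> e * norm (y - x)" if y: "y \<in> S" "dist y x < d" for y
    proof (cases "y = x")
      case True
      \<comment> \<open>the filter \<open>at x within S\<close> says nothing about \<open>x\<close> itself\<close>
      have "A x 0 = 0" using A_scale[OF \<open>x \<in> S\<close> subspace_0[OF E], of 0] by simp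
      then show ?thesis using True by simp
    next
      case False
      then show ?thesis
        using d(2) y D0 \<open>x \<in> S\<close> by (auto simp: norm_le_on_def A_def)
    qed
    then show ?thesis using d(1) by blast
  qed
  have cont: "\<exists>d>0. \<forall>y\<in>S. dist y x < d \<longrightarrow> (\<forall>v\<in>E. norm (A y v - A x v) \<le> e * norm v)"
    if "x \<in> S" "e > 0" for x e
  proof -
    have "\<forall>\<^sub>F y in at x within S. norm_le_on 1 E (\<lambda>vs. D 1 y vs - D 1 x vs) e"
      using D1 k(1) that by blast
    then obtain d where d: "d > 0" "\<forall>y\<in>S. y \<noteq> x \<and> dist y x < d \<longrightarrow>
        norm_le_on 1 E (\<lambda>vs. D 1 y vs - D 1 x vs) e"
      unfolding eventually_at by blast
    have "norm (A y v - A x v) \<le> e * norm v" if y: "y \<in> S" "dist y x < d" "v \<in> E" for y v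
    proof (cases "y = x")
      case True
      then show ?thesis using \<open>e > 0\<close> by simp
    next
      case False
      then have "norm_le_on 1 E (\<lambda>vs. D 1 y vs - D 1 x vs) e" using d(2) y by blast
      then have "length [v] = 1 \<and> set [v] \<subseteq> E \<longrightarrow>
          norm (D 1 y [v] - D 1 x [v]) \<le> e * prod_list (map norm [v])"
        unfolding norm_le_on_def by blast
      then show ?thesis using y(3) by (simp add: A_def)
    qed
    then show ?thesis using d(1) by blast
  qed
  show ?thesis
  proof (rule that[of "A x0"])
    fix \<epsilon> :: real assume \<epsilon>: "0 < \<epsilon>"
    obtain d1 where d1: "d1 > 0" "\<And>y v. y \<in> S \<Longrightarrow> dist y x0 < d1 \<Longrightarrow> v \<in> E \<Longrightarrow> norm (A y v - A x0 v) \<le> \<epsilon> * norm v"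
      using cont[of x0 \<epsilon>] C \<epsilon> by blast
    obtain d2 where d2: "d2 > 0" "\<And>y. y \<in> E \<Longrightarrow> dist y x0 < d2 \<Longrightarrow> y \<in> C"
      using C(2,3) unfolding openin_euclidean_subtopology_iff by blast
    define \<delta> where "\<delta> = min d1 d2"
    have "norm (f y - f x - A x0 (y - x)) \<le> \<epsilon> * norm (y - x)"
      if xy: "x \<in> E" "y \<in> E" "dist x x0 < \<delta>" "dist y x0 < \<delta>" for x y
    proof -
      define w where "w = y - x"
      define p where "p t = x + t *\<^sub>R w" for t
      have w: "w \<in> E" using xy E by (simp add: w_def subspace_diff)
      have pE: "p t \<in> E" for t
        using xy(1) w E by (simp add: p_def subspace_add subspace_scale)
      have p_ball: "p t \<in> ball x0 \<delta>" if "t \<in> {0..1}" for t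
      proof -
        have "p t = (1 - t) *\<^sub>R x + t *\<^sub>R y" by (simp add: p_def w_def algebra_simps)
        then show ?thesis
          using convexD_alt[OF convex_ball[of x0 \<delta>], of x y t] xy that by (simp add: dist_commute)
      qed
      have pS: "p t \<in> S" and p_near: "dist (p t) x0 < d1" if "t \<in> {0..1}" for t
        using p_ball[OF that] d2(2)[OF pE] C(1) by (auto simp: \<delta>_def dist_commute)
      have der: "((\<lambda>t. f (p t) - t *\<^sub>R A x0 w) has_derivative (\<lambda>h. h *\<^sub>R (A (p t) w - A x0 w)))
          (at t within {0..1})" if t: "t \<in> {0..1}" for t
        unfolding has_derivative_within_alt
      proof (intro conjI allI impI)
        show "bounded_linear (\<lambda>h. h *\<^sub>R (A (p t) w - A x0 w))"
          by (rule bounded_linear_scaleR_left)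
        fix e :: real assume e: "e > 0"
        define c where "c = norm w + 1"
        have c: "c > 0" "norm w \<le> c" by (auto simp: c_def add_nonneg_pos)
        obtain d where d: "d > 0" "\<forall>y\<in>S. dist y (p t) < d \<longrightarrow>
            norm (f y - f (p t) - A (p t) (y - p t)) \<le> (e / c) * norm (y - p t)"
          using deriv[OF pS[OF t], of "e / c"] e c by auto
        show "\<exists>d>0. \<forall>u\<in>{0..1}. norm (u - t) < d \<longrightarrow>
          norm (f (p u) - u *\<^sub>R A x0 w - (f (p t) - t *\<^sub>R A x0 w) - (u - t) *\<^sub>R (A (p t) w - A x0 w))
             \<le> e * norm (u - t)"
        proof (intro exI[of _ "d / c"] conjI ballI impI)
          show "d / c > 0" using d(1) c by simp
          fix u :: real assume u: "u \<in> {0..1}" "norm (u - t) < d / c"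
          have pu: "p u - p t = (u - t) *\<^sub>R w" by (simp add: p_def algebra_simps)
          have le: "norm (p u - p t) \<le> norm (u - t) * c"
            using c by (simp add: pu mult_left_mono)
          also have "\<dots> < d" using u(2) c by (simp add: field_simps)
          finally have "norm (f (p u) - f (p t) - A (p t) (p u - p t)) \<le> (e / c) * norm (p u - p t)"
            using d(2) pS[OF u(1)] by (simp add: dist_norm)
          also have "\<dots> \<le> (e / c) * (norm (u - t) * c)"
            using le e c by (intro mult_left_mono) auto
          also have "\<dots> = e * norm (u - t)" using c by simp
          finally have le: "norm (f (p u) - f (p t) - A (p t) (p u - p t)) \<le> e * norm (u - t)" .
          have "A (p t) (p u - p t) = (u - t) *\<^sub>R A (p t) w"
            unfolding pu by (rule A_scale[OF pS[OF t] w])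
          with le show "norm (f (p u) - u *\<^sub>R A x0 w - (f (p t) - t *\<^sub>R A x0 w)
              - (u - t) *\<^sub>R (A (p t) w - A x0 w)) \<le> e * norm (u - t)"
            by (simp add: algebra_simps)
        qed
      qed
      have "norm ((f (p 1) - 1 *\<^sub>R A x0 w) - (f (p 0) - 0 *\<^sub>R A x0 w)) \<le> (\<epsilon> * norm w) * norm (1 - (0::real))"
      proof (rule differentiable_bound[OF convex_real_interval(5) der])
        fix t :: real assume t: "t \<in> {0..1}"
        have "norm (A (p t) w - A x0 w) \<le> \<epsilon> * norm w"
          using d1(2)[OF pS[OF t] p_near[OF t] w] .
        then show "onorm (\<lambda>h. h *\<^sub>R (A (p t) w - A x0 w)) \<le> \<epsilon> * norm w"
          by (intro onorm_le) (simp add: mult.commute mult_left_mono)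
      qed auto
      then show ?thesis by (simp add: p_def w_def algebra_simps)
    qed
    then show "\<exists>\<delta>>0. \<forall>x\<in>E. \<forall>y\<in>E. dist x x0 < \<delta> \<longrightarrow> dist y x0 < \<delta> \<longrightarrow>
      x \<in> C \<and> norm (f y - f x - A x0 (y - x)) \<le> \<epsilon> * norm (y - x)"
      using d1(1) d2 by (intro exI[of _ \<delta>]) (auto simp: \<delta>_def)
  qed
qed

lemma banach_model_subspace: "banach_model E \<Longrightarrow> subspace E"
  unfolding banach_model_def
  by (metis bounded_linear.linear linear_subspace_image subspace_UNIV)

context
  fixes M :: "('q, 'e::banach) manifold" and c :: "('q, 'e) chart"
  assumes c: "chart_of M c"
begin

lemma chart_inj: "inj_on (cmap c) (cdom c)"
  and chart_dom_subset: "cdom c \<subseteq> points M"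
  and chart_image_subset: "cmap c ` cdom c \<subseteq> cmodel c"
proof -
  have "openin (mtop M) (cdom c)" using c by (simp add: chart_of_def)
  then show sub: "cdom c \<subseteq> points M" by (rule openin_subset)
  then show "inj_on (cmap c) (cdom c)"
    using c homeomorphic_imp_injective_map unfolding chart_of_def
    by (metis inf.absorb2 topspace_subtopology)
  show "cmap c ` cdom c \<subseteq> cmodel c"
    using c openin_imp_subset unfolding chart_of_def by blast
qed

lemma chart_image_openin:
  assumes "openin (mtop M) W" "W \<subseteq> cdom c"
  shows "openin (top_of_set (cmodel c)) (cmap c ` W)"
proof -
  have "openin (subtopology (mtop M) (cdom c)) W"
    using assms openin_subset_topspace_eq by (metis inf.absorb_iff2 openin_subtopology_Int2)
  moreover have "open_map (subtopology (mtop M) (cdom c)) (top_of_set (cmap c ` cdom c)) (cmap c)"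
    using c homeomorphic_imp_open_map unfolding chart_of_def by blast
  ultimately have "openin (top_of_set (cmap c ` cdom c)) (cmap c ` W)"
    unfolding open_map_def by blast
  then show ?thesis
    using c openin_trans unfolding chart_of_def by blast
qed

lemma chart_ball_openin: "openin (mtop M) {p \<in> cdom c. norm (cmap c p - a) < \<delta>}"
proof -
  have "continuous_map (subtopology (mtop M) (cdom c)) (top_of_set (cmap c ` cdom c)) (cmap c)"
    using c homeomorphic_imp_continuous_map unfolding chart_of_def by blast
  then have "continuous_map (subtopology (mtop M) (cdom c)) euclidean (cmap c)"
    by (simp add: continuous_map_in_subtopology)
  then have "openin (subtopology (mtop M) (cdom c))
      {p \<in> topspace (subtopology (mtop M) (cdom c)). cmap c p \<in> ball a \<delta>}"
    by (rule openin_continuous_map_preimage) auto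
  moreover have "{p \<in> topspace (subtopology (mtop M) (cdom c)). cmap c p \<in> ball a \<delta>}
      = {p \<in> cdom c. norm (cmap c p - a) < \<delta>}"
    using chart_dom_subset by (auto simp: dist_norm norm_minus_commute)
  ultimately show ?thesis
    using c openin_trans_full unfolding chart_of_def by metis
qed

lemma chart_ball_small:
  assumes W: "openin (mtop M) W" "q \<in> W" and q: "q \<in> cdom c"
  obtains \<delta> where "\<delta> > 0" "{p \<in> cdom c. norm (cmap c p - cmap c q) < \<delta>} \<subseteq> W"
proof -
  have "openin (top_of_set (cmodel c)) (cmap c ` (W \<inter> cdom c))"
    using W(1) c by (intro chart_image_openin openin_Int) (auto simp: chart_of_def)
  then obtain \<delta> where \<delta>: "\<delta> > 0"
    "\<And>x. x \<in> cmodel c \<Longrightarrow> dist x (cmap c q) < \<delta> \<Longrightarrow> x \<in> cmap c ` (W \<inter> cdom c)"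
    unfolding openin_euclidean_subtopology_iff using W(2) q by blast
  have "p \<in> W" if "p \<in> cdom c" "norm (cmap c p - cmap c q) < \<delta>" for p
  proof -
    have "cmap c p \<in> cmap c ` (W \<inter> cdom c)"
      using \<delta>(2) that chart_image_subset by (auto simp: dist_norm)
    then show ?thesis using inj_onD[OF chart_inj] that(1) by blast
  qed
  then show ?thesis using that \<delta>(1) by blast
qed

end

section \<open>Closed subgroups of Lie groups\<close>

text \<open>
  With \<open>x\<close> fixed the product changes by \<open>A (0, w)\<close> when the second factor moves from \<open>\<one>\<close> by \<open>w\<close>, up
  to a small multiple of \<open>norm w\<close>, and \<open>A\<close> is independent of \<open>x\<close>.  For \<open>x = \<one>\<close> the change is \<open>w\<close>
  itself, so \<open>A (0, w)\<close> can be eliminated.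
\<close>

lemma lie_group_mult_approx:
  assumes lie: "lie_group G M" and c: "c \<in> atlas M" and one: "\<one>\<^bsub>G\<^esub> \<in> cdom c" and "0 < \<epsilon>"
  defines "\<phi> \<equiv> \<lambda>g. cmap c g - cmap c \<one>\<^bsub>G\<^esub>"
  shows "\<exists>\<delta>>0. \<forall>x\<in>cdom c. \<forall>y\<in>cdom c. norm (\<phi> x) < \<delta> \<longrightarrow> norm (\<phi> y) < \<delta> \<longrightarrow>
    x \<otimes>\<^bsub>G\<^esub> y \<in> cdom c \<and> norm (\<phi> (x \<otimes>\<^bsub>G\<^esub> y) - \<phi> x - \<phi> y) \<le> \<epsilon> * norm (\<phi> y)"
proof -
  interpret group G using lie by (simp add: lie_group_def)
  define e where "e = cmap c \<one>\<^bsub>G\<^esub>"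
  have pts: "points M = carrier G" using lie by (simp add: lie_group_def)
  have chart: "chart_of M c" using lie c by (auto simp: lie_group_def banach_manifold_def)
  note inj = chart_inj[OF chart]
  have dom: "openin (mtop M) (cdom c)" "cdom c \<subseteq> carrier G"
    using chart chart_dom_subset[OF chart] by (auto simp: chart_of_def pts)
  have E: "subspace (cmodel c)" using chart by (simp add: chart_of_def banach_model_subspace)
  have smooth: "Ck_map \<infinity> (prod_manifold M M) M (\<lambda>(g, h). g \<otimes>\<^bsub>G\<^esub> h)"
    using lie by (simp add: lie_group_def)
  then have cont: "continuous_map (prod_topology (mtop M) (mtop M)) (mtop M) (\<lambda>(g, h). g \<otimes>\<^bsub>G\<^esub> h)"
    by (simp add: Ck_map_def prod_manifold_def)
  define S where "S = map_prod (cmap c) (cmap c) ` {p \<in> cdom c \<times> cdom c. (\<lambda>(g, h). g \<otimes>\<^bsub>G\<^esub> h) p \<in> cdom c}"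
  define f where "f = cmap c \<circ> (\<lambda>(g, h). g \<otimes>\<^bsub>G\<^esub> h) \<circ> cinv (prod_chart c c)"
  have "Ck_on \<infinity> (cmodel (prod_chart c c)) (cmap (prod_chart c c) `
        {p \<in> cdom (prod_chart c c). (\<lambda>(g, h). g \<otimes>\<^bsub>G\<^esub> h) p \<in> cdom c}) f"
    using smooth c unfolding Ck_map_def f_def prod_manifold_def by auto
  then have Ck: "Ck_on \<infinity> (cmodel c \<times> cmodel c) S f"
    by (simp add: S_def prod_chart_def)
  have f_eq: "f (cmap c x, cmap c y) = cmap c (x \<otimes>\<^bsub>G\<^esub> y)" if "x \<in> cdom c" "y \<in> cdom c" for x y
  proof -
    have "inj_on (map_prod (cmap c) (cmap c)) (cdom c \<times> cdom c)"
      using inj by (intro map_prod_inj_on)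
    from inv_into_f_f[OF this, of "(x, y)"] show ?thesis
      using that by (simp add: f_def cinv_def prod_chart_def)
  qed
  define P where "P = {p \<in> topspace (prod_topology (mtop M) (mtop M)). (\<lambda>(g, h). g \<otimes>\<^bsub>G\<^esub> h) p \<in> cdom c}"
  have "openin (prod_topology (mtop M) (mtop M)) P"
    unfolding P_def by (rule openin_continuous_map_preimage[OF cont dom(1)])
  then have "\<And>x y. (x, y) \<in> P \<Longrightarrow> \<exists>U V. openin (mtop M) U \<and> openin (mtop M) V \<and> x \<in> U \<and> y \<in> V \<and> U \<times> V \<subseteq> P"
    unfolding openin_prod_topology_alt by simp
  moreover have "(\<one>\<^bsub>G\<^esub>, \<one>\<^bsub>G\<^esub>) \<in> P" using one by (simp add: P_def pts)
  ultimately obtain U V where UV: "openin (mtop M) U" "openin (mtop M) V" "\<one>\<^bsub>G\<^esub> \<in> U" "\<one>\<^bsub>G\<^esub> \<in> V"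
    "U \<times> V \<subseteq> P"
    by meson
  define N where "N = U \<inter> V \<inter> cdom c"
  have N: "openin (mtop M) N" "\<one>\<^bsub>G\<^esub> \<in> N" "N \<subseteq> cdom c"
    using UV dom(1) one by (auto simp: N_def)
  have N_mult: "x \<otimes>\<^bsub>G\<^esub> y \<in> cdom c" if "x \<in> N" "y \<in> N" for x y
    using UV(5) that by (auto simp: N_def P_def)
  define C where "C = cmap c ` N \<times> cmap c ` N"
  have C_open: "openin (top_of_set (cmodel c \<times> cmodel c)) C"
    unfolding C_def using chart_image_openin[OF chart N(1,3)] by (intro openin_Times)
  have CS: "C \<subseteq> S"
  proof
    fix p assume "p \<in> C"
    then obtain x y where xy: "x \<in> N" "y \<in> N" "p = map_prod (cmap c) (cmap c) (x, y)"
      by (auto simp: C_def)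
    then show "p \<in> S"
      unfolding S_def using N(3) N_mult by (intro image_eqI[of _ _ "(x, y)"]) auto
  qed
  obtain A where A: "\<And>\<epsilon>. 0 < \<epsilon> \<Longrightarrow> \<exists>\<delta>>0. \<forall>p\<in>cmodel c \<times> cmodel c. \<forall>q\<in>cmodel c \<times> cmodel c.
      dist p (e, e) < \<delta> \<longrightarrow> dist q (e, e) < \<delta> \<longrightarrow>
      p \<in> C \<and> norm (f q - f p - A (q - p)) \<le> \<epsilon> * norm (q - p)"
    using Ck_on_strict_derivative[OF Ck _ CS C_open _ subspace_Times[OF E E], of "(e, e)"] N(2)
    by (auto simp: C_def e_def)
  obtain \<delta> where \<delta>: "\<delta> > 0" and diff: "\<And>p q. p \<in> cmodel c \<times> cmodel c \<Longrightarrow> q \<in> cmodel c \<times> cmodel c \<Longrightarrow>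
      dist p (e, e) < \<delta> \<Longrightarrow> dist q (e, e) < \<delta> \<Longrightarrow>
      p \<in> C \<and> norm (f q - f p - A (q - p)) \<le> \<epsilon>/2 * norm (q - p)"
    using A[of "\<epsilon>/2"] \<open>0 < \<epsilon>\<close> by (meson half_gt_zero)
  show ?thesis
  proof (intro exI[of _ "\<delta>/2"] conjI ballI impI)
    show "\<delta>/2 > 0" using \<delta> by simp
    fix x y assume xy: "x \<in> cdom c" "y \<in> cdom c" "norm (\<phi> x) < \<delta>/2" "norm (\<phi> y) < \<delta>/2"
    have mem: "cmap c x \<in> cmodel c" "cmap c y \<in> cmodel c" "e \<in> cmodel c"
      using chart_image_subset[OF chart] xy one by (auto simp: e_def)
    have near: "dist (cmap c x, cmap c y) (e, e) < \<delta>" "dist (cmap c x, e) (e, e) < \<delta>"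
      "dist (e, cmap c y) (e, e) < \<delta>" "dist (e, e) (e, e) < \<delta>"
      using norm_Pair_le[of "cmap c x - e" "cmap c y - e"] xy(3,4) \<delta>
      by (auto simp: dist_norm \<phi>_def e_def norm_Pair)
    have "(cmap c x, cmap c y) \<in> C" using diff mem near(1) by auto
    then have "x \<in> N" "y \<in> N"
      using xy(1,2) N(3) inj_onD[OF inj] by (auto simp: C_def)
    then show "x \<otimes>\<^bsub>G\<^esub> y \<in> cdom c" by (rule N_mult)
    have carr: "x \<in> carrier G" "y \<in> carrier G" using xy dom(2) by auto
    define w where "w = cmap c y - e"
    have "norm (f (cmap c x, cmap c y) - f (cmap c x, e) - A (0, w)) \<le> \<epsilon>/2 * norm w"
      using diff[of "(cmap c x, e)" "(cmap c x, cmap c y)"] mem near by (simp add: w_def norm_Pair)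
    moreover have "norm (f (e, cmap c y) - f (e, e) - A (0, w)) \<le> \<epsilon>/2 * norm w"
      using diff[of "(e, e)" "(e, cmap c y)"] mem near by (simp add: w_def norm_Pair)
    moreover have "f (cmap c x, e) = cmap c x" "f (e, cmap c y) = cmap c y" "f (e, e) = e"
      "f (cmap c x, cmap c y) = cmap c (x \<otimes>\<^bsub>G\<^esub> y)"
      using f_eq[of x "\<one>\<^bsub>G\<^esub>"] f_eq[of "\<one>\<^bsub>G\<^esub>" y] f_eq[of "\<one>\<^bsub>G\<^esub>" "\<one>\<^bsub>G\<^esub>"] f_eq[of x y] xy one carr
      by (auto simp: e_def)
    ultimately have "norm (cmap c (x \<otimes>\<^bsub>G\<^esub> y) - cmap c x - A (0, w)) \<le> \<epsilon>/2 * norm w"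
      "norm (w - A (0, w)) \<le> \<epsilon>/2 * norm w"
      by (auto simp: w_def)
    moreover have "norm ((cmap c (x \<otimes>\<^bsub>G\<^esub> y) - cmap c x) - w)
        \<le> norm (cmap c (x \<otimes>\<^bsub>G\<^esub> y) - cmap c x - A (0, w)) + norm (w - A (0, w))"
      by norm
    ultimately have "norm ((cmap c (x \<otimes>\<^bsub>G\<^esub> y) - cmap c x) - w) \<le> \<epsilon> * norm w"
      by linarith
    then show "norm (\<phi> (x \<otimes>\<^bsub>G\<^esub> y) - \<phi> x - \<phi> y) \<le> \<epsilon> * norm (\<phi> y)"
      by (simp add: \<phi>_def w_def e_def)
  qed
qed

lemma lie_group_translations_continuous:
  assumes "lie_group G M" "a \<in> carrier G"
  shows "continuous_map (mtop M) (mtop M) (\<lambda>x. x \<otimes>\<^bsub>G\<^esub> a)"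
    and "continuous_map (mtop M) (mtop M) (\<lambda>x. a \<otimes>\<^bsub>G\<^esub> x)"
proof -
  have pts: "points M = carrier G" using assms by (simp add: lie_group_def)
  have cont: "continuous_map (prod_topology (mtop M) (mtop M)) (mtop M) (\<lambda>(g, h). g \<otimes>\<^bsub>G\<^esub> h)"
    using assms by (simp add: lie_group_def Ck_map_def prod_manifold_def)
  have "continuous_map (mtop M) (prod_topology (mtop M) (mtop M)) (\<lambda>x. (x, a))"
    "continuous_map (mtop M) (prod_topology (mtop M) (mtop M)) (\<lambda>x. (a, x))"
    using assms(2) by (auto simp: pts intro!: continuous_map_pairedI)
  from this[THEN continuous_map_compose, OF cont]
  show "continuous_map (mtop M) (mtop M) (\<lambda>x. x \<otimes>\<^bsub>G\<^esub> a)"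
    "continuous_map (mtop M) (mtop M) (\<lambda>x. a \<otimes>\<^bsub>G\<^esub> x)"
    by (simp_all add: o_def)
qed

lemma lie_group_local_coordinates:
  assumes lie: "lie_group G M" and c: "c \<in> atlas M" and one: "\<one>\<^bsub>G\<^esub> \<in> cdom c"
  shows "local_coordinates G (cdom c) (\<lambda>g. cmap c g - cmap c \<one>\<^bsub>G\<^esub>)"
proof -
  interpret group G using lie by (simp add: lie_group_def)
  have pts: "points M = carrier G" using lie by (simp add: lie_group_def)
  have chart: "chart_of M c" using lie c by (auto simp: lie_group_def banach_manifold_def)
  show ?thesis
  proof
    show "cdom c \<subseteq> carrier G" using chart_dom_subset[OF chart] by (simp add: pts)
    fix \<epsilon> :: real assume \<epsilon>: "0 < \<epsilon>"
    let ?V = "{p \<in> cdom c. norm (cmap c p - cmap c \<one>\<^bsub>G\<^esub>) < \<epsilon>}"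
    have "continuous_map (mtop M) (mtop M) (\<lambda>g. inv\<^bsub>G\<^esub> g)"
      using lie by (simp add: lie_group_def Ck_map_def)
    from openin_continuous_map_preimage[OF this chart_ball_openin[OF chart]]
    have V: "openin (mtop M) {g \<in> points M. inv\<^bsub>G\<^esub> g \<in> ?V}" .
    have V1: "\<one>\<^bsub>G\<^esub> \<in> {g \<in> points M. inv\<^bsub>G\<^esub> g \<in> ?V}" using one \<epsilon> by (simp add: pts)
    obtain \<delta> where "\<delta> > 0"
      "{p \<in> cdom c. norm (cmap c p - cmap c \<one>\<^bsub>G\<^esub>) < \<delta>} \<subseteq> {g \<in> points M. inv\<^bsub>G\<^esub> g \<in> ?V}"
      by (rule chart_ball_small[OF chart V V1 one])
    then show "\<exists>\<delta>>0. \<forall>x\<in>cdom c. norm (cmap c x - cmap c \<one>\<^bsub>G\<^esub>) < \<delta> \<longrightarrow>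
        inv\<^bsub>G\<^esub> x \<in> cdom c \<and> norm (cmap c (inv\<^bsub>G\<^esub> x) - cmap c \<one>\<^bsub>G\<^esub>) < \<epsilon>"
      by blast
  qed (use lie_group_mult_approx[OF lie c one] one in auto)
qed

lemma lie_group_subgroup_isolated:
  assumes lie: "lie_group G M" and H: "subgroup H G" "closedin (mtop M) H"
  obtains W where "openin (mtop M) W" "\<one>\<^bsub>G\<^esub> \<in> W"
    "\<And>K. subgroup K G \<Longrightarrow> H \<subseteq> K \<Longrightarrow> (\<And>k. k \<in> K \<Longrightarrow> \<exists>h\<in>H. k \<otimes>\<^bsub>G\<^esub> h \<in> W) \<Longrightarrow> K = H"
proof -
  interpret group G using lie by (simp add: lie_group_def)
  have man: "banach_manifold M" and pts: "points M = carrier G"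
    using lie by (auto simp: lie_group_def)
  then obtain c where c: "c \<in> atlas M" and one: "\<one>\<^bsub>G\<^esub> \<in> cdom c"
    unfolding banach_manifold_def by (metis UN_iff one_closed)
  have chart: "chart_of M c" using man c by (simp add: banach_manifold_def)
  interpret local_coordinates G "cdom c" "\<lambda>g. cmap c g - cmap c \<one>\<^bsub>G\<^esub>"
    by (rule lie_group_local_coordinates[OF lie c one])
  have closed: "x \<in> H" if x: "x \<in> carrier G" and near: "\<And>\<delta>. \<delta> > 0 \<Longrightarrow> \<exists>h\<in>H. x \<otimes>\<^bsub>G\<^esub> h \<in> coord_ball \<delta>" for x
  proof (rule ccontr)
    assume "x \<notin> H"
    then have "inv\<^bsub>G\<^esub> x \<notin> H" using x subgroup.m_inv_closed[OF H(1)] by fastforce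
    let ?V = "{y \<in> points M. inv\<^bsub>G\<^esub> x \<otimes>\<^bsub>G\<^esub> y \<in> points M - H}"
    have V: "openin (mtop M) ?V"
      using lie_group_translations_continuous(2)[OF lie, of "inv\<^bsub>G\<^esub> x"] x H(2)
      by (intro openin_continuous_map_preimage[of _ "mtop M"]) auto
    have V1: "\<one>\<^bsub>G\<^esub> \<in> ?V" using x \<open>inv\<^bsub>G\<^esub> x \<notin> H\<close> by (simp add: pts)
    obtain \<delta> where "\<delta> > 0" "coord_ball \<delta> \<subseteq> ?V"
      unfolding coord_ball_def by (rule chart_ball_small[OF chart V V1 one])
    then obtain h where "h \<in> H" "inv\<^bsub>G\<^esub> x \<otimes>\<^bsub>G\<^esub> (x \<otimes>\<^bsub>G\<^esub> h) \<notin> H" using near by blast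
    moreover have "inv\<^bsub>G\<^esub> x \<otimes>\<^bsub>G\<^esub> (x \<otimes>\<^bsub>G\<^esub> h) = h"
      using x \<open>h \<in> H\<close> subgroup.mem_carrier[OF H(1)] m_assoc[of "inv\<^bsub>G\<^esub> x" x h] by simp
    ultimately show False by simp
  qed
  obtain \<delta> where \<delta>: "\<delta> > 0" "\<forall>K. subgroup K G \<longrightarrow> H \<subseteq> K \<longrightarrow> (\<forall>k\<in>K. \<exists>h\<in>H. k \<otimes>\<^bsub>G\<^esub> h \<in> coord_ball \<delta>) \<longrightarrow> K = H"
    using closed_subgroup_isolated[OF H(1) closed] by blast
  show ?thesis
  proof (rule that[of "coord_ball \<delta>"])
    show "openin (mtop M) (coord_ball \<delta>)"
      unfolding coord_ball_def by (rule chart_ball_openin[OF chart])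
    show "\<one>\<^bsub>G\<^esub> \<in> coord_ball \<delta>" using one \<delta>(1) by (simp add: coord_ball_def)
  qed (use \<delta>(2) in blast)
qed

section \<open>Proper actions on Banach manifolds\<close>

text \<open>
  Charts make the topology of \<open>N\<close> first countable, so a failure of openness at \<open>q\<close> is
  witnessed by a sequence, to which properness applies.
\<close>

lemma isotropy_type_set_openin:
  assumes lie: "lie_group G M" and H: "subgroup H G" "closedin (mtop M) H"
    and N: "banach_manifold N" and act: "group_action G (points N) \<Phi>"
    and cont: "continuous_map (prod_topology (mtop M) (mtop N)) (mtop N) (\<lambda>(g, q). \<Phi> g q)"
    and proper: "proper_action (mtop M) (mtop N) \<Phi>"
  shows "openin (subtopology (mtop N) (fixed_point_set G (points N) \<Phi> H))
    (isotropy_type_set G (points N) \<Phi> H)"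
proof -
  interpret group G using lie by (simp add: lie_group_def)
  have pts: "points M = carrier G" using lie by (auto simp: lie_group_def)
  let ?F = "fixed_point_set G (points N) \<Phi> H" and ?I = "isotropy_type_set G (points N) \<Phi> H"
  obtain W where W: "openin (mtop M) W" "\<one>\<^bsub>G\<^esub> \<in> W"
    and rigid: "\<And>K. subgroup K G \<Longrightarrow> H \<subseteq> K \<Longrightarrow> (\<And>k. k \<in> K \<Longrightarrow> \<exists>h\<in>H. k \<otimes>\<^bsub>G\<^esub> h \<in> W) \<Longrightarrow> K = H"
    using lie_group_subgroup_isolated[OF lie H] by blast
  have local_open: "\<exists>V. openin (mtop N) V \<and> q \<in> V \<and> V \<inter> ?F \<subseteq> ?I" if q: "q \<in> ?I" for q
  proof (rule ccontr)
    assume contra: "\<not> ?thesis"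
    have qN: "q \<in> points N" and stab_q: "stabilizer G \<Phi> q = H"
      using q by (auto simp: isotropy_type_set_def)
    then obtain c where c: "c \<in> atlas N" and qc: "q \<in> cdom c"
      using N unfolding banach_manifold_def by (metis UN_iff)
    have chart: "chart_of N c" using N c by (simp add: banach_manifold_def)
    define V where "V n = {p \<in> cdom c. norm (cmap c p - cmap c q) < inverse (real (Suc n))}" for n
    have V: "openin (mtop N) (V n)" "q \<in> V n" for n
      using chart_ball_openin[OF chart] qc by (auto simp: V_def)
    have "\<forall>n. \<exists>p g. p \<in> V n \<and> p \<in> points N \<and> g \<in> stabilizer G \<Phi> p \<and> (\<forall>h\<in>H. g \<otimes>\<^bsub>G\<^esub> h \<notin> W)"
    proof
      fix n
      obtain p where p: "p \<in> V n" "p \<in> ?F" "p \<notin> ?I" using contra V[of n] by blast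
      then have pN: "p \<in> points N" and "H \<subseteq> stabilizer G \<Phi> p" "stabilizer G \<Phi> p \<noteq> H"
        by (auto simp: isotropy_type_set_def fixed_point_set_def)
      with rigid[OF group_action.stabilizer_subgroup[OF act pN]] p(1)
      show "\<exists>p g. p \<in> V n \<and> p \<in> points N \<and> g \<in> stabilizer G \<Phi> p \<and> (\<forall>h\<in>H. g \<otimes>\<^bsub>G\<^esub> h \<notin> W)" by blast
    qed
    then obtain p g where p: "\<And>n. p n \<in> V n" "\<And>n. p n \<in> points N"
      and g: "\<And>n. g n \<in> stabilizer G \<Phi> (p n)" and far: "\<And>n h. h \<in> H \<Longrightarrow> g n \<otimes>\<^bsub>G\<^esub> h \<notin> W"
      by metis
    have g': "g n \<in> carrier G" "\<Phi> (g n) (p n) = p n" for n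
      using g by (auto simp: stabilizer_def)
    have lim_p: "limitin (mtop N) p q sequentially"
      unfolding limitin_sequentially
    proof (intro conjI allI impI qN)
      fix U assume U: "openin (mtop N) U \<and> q \<in> U"
      then obtain \<delta> where \<delta>: "\<delta> > 0" "{p \<in> cdom c. norm (cmap c p - cmap c q) < \<delta>} \<subseteq> U"
        using chart_ball_small[OF chart _ _ qc] by blast
      obtain n0 where n0: "inverse (real (Suc n0)) < \<delta>" using reals_Archimedean[OF \<delta>(1)] by blast
      have "p n \<in> U" if "n \<ge> n0" for n
      proof -
        have "inverse (real (Suc n)) \<le> inverse (real (Suc n0))" using that by (simp add: field_simps)
        moreover have "p n \<in> cdom c" "norm (cmap c (p n) - cmap c q) < inverse (real (Suc n))"
          using p(1)[of n] unfolding V_def by blast+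
        ultimately have "norm (cmap c (p n) - cmap c q) < \<delta>" using n0 by linarith
        with \<open>p n \<in> cdom c\<close> show ?thesis using \<delta>(2) by blast
      qed
      then show "\<exists>n0. \<forall>n. n0 \<le> n \<longrightarrow> p n \<in> U" by blast
    qed
    have seqs: "range g \<subseteq> points M \<and> range p \<subseteq> points N \<and> (\<exists>a. limitin (mtop N) p a sequentially) \<and>
        (\<exists>b. limitin (mtop N) (\<lambda>n. \<Phi> (g n) (p n)) b sequentially)"
      using g' p(2) lim_p by (auto simp: pts)
    then obtain \<sigma> l where \<sigma>: "strict_mono \<sigma>" and lim_g: "limitin (mtop M) (g \<circ> \<sigma>) l sequentially"
      using proper[unfolded proper_action_def, rule_format, OF seqs] by blast
    have l: "l \<in> carrier G" using limitin_topspace[OF lim_g] by (simp add: pts)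
    have "limitin (prod_topology (mtop M) (mtop N)) (\<lambda>n. ((g \<circ> \<sigma>) n, (p \<circ> \<sigma>) n)) (l, q) sequentially"
      using lim_g limitin_subsequence[OF \<sigma> lim_p] by (simp add: limitin_pairwise o_def)
    from continuous_map_limit[OF cont this]
    have lim: "limitin (mtop N) (p \<circ> \<sigma>) (\<Phi> l q) sequentially"
      using g'(2) by (simp add: o_def)
    have "Hausdorff_space (mtop N)" using N by (simp add: banach_manifold_def)
    then have "\<Phi> l q = q"
      by (rule limitin_Hausdorff_unique[OF lim limitin_subsequence[OF \<sigma> lim_p] sequentially_bot])
    then have "l \<in> H" using stab_q l by (auto simp: stabilizer_def)
    then have "inv\<^bsub>G\<^esub> l \<in> H" by (rule subgroup.m_inv_closed[OF H(1)])
    \<comment> \<open>translating by \<open>inv l \<in> H\<close> moves the subsequence into \<open>W\<close>\<close>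
    have "limitin (mtop M) ((\<lambda>x. x \<otimes>\<^bsub>G\<^esub> inv\<^bsub>G\<^esub> l) \<circ> (g \<circ> \<sigma>)) (l \<otimes>\<^bsub>G\<^esub> inv\<^bsub>G\<^esub> l) sequentially"
      using lie_group_translations_continuous(1)[OF lie] l by (intro continuous_map_limit[OF _ lim_g]) auto
    then obtain n where "g (\<sigma> n) \<otimes>\<^bsub>G\<^esub> inv\<^bsub>G\<^esub> l \<in> W"
      unfolding limitin_sequentially using W l by (auto simp: o_def)
    then show False using far \<open>inv\<^bsub>G\<^esub> l \<in> H\<close> by blast
  qed
  have "?I \<subseteq> ?F" by (auto simp: isotropy_type_set_def fixed_point_set_def)
  show ?thesis
  proof (subst openin_subopen, rule ballI)
    fix q assume q: "q \<in> ?I"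
    then obtain V where V: "openin (mtop N) V" "q \<in> V" "V \<inter> ?F \<subseteq> ?I" using local_open by blast
    show "\<exists>T. openin (subtopology (mtop N) ?F) T \<and> q \<in> T \<and> T \<subseteq> ?I"
      using V q \<open>?I \<subseteq> ?F\<close> by (intro exI[of _ "V \<inter> ?F"] conjI openin_subtopology_Int) auto
  qed
qed

theorem theorem3p8:
  fixes s0 :: real
    and Q :: "real \<Rightarrow> ('q, 'e::banach) manifold"
    and K :: "real \<Rightarrow> 'q \<Rightarrow> ('q set \<times> ('q \<Rightarrow> ('q, 'e) tangent)) set"
    and \<gamma> :: "real \<Rightarrow> 'q \<Rightarrow> ('q, 'e) tangent \<Rightarrow> ('q, 'e) tangent \<Rightarrow> real"
    and G :: "('g, 'm) monoid_scheme"
    and M :: "('g, 'h::euclidean_space) manifold"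
    and \<Phi> :: "real \<Rightarrow> 'g \<Rightarrow> 'q \<Rightarrow> 'q"
    and H :: "'g set"
  assumes "banach_manifold_chain s0 Q K"
    and "compatible_weak_metric s0 Q \<gamma>"
    and "lie_group G M"
    and "chain_action G M s0 Q \<Phi>"
    and "subgroup H G"
    and "compactin (mtop M) H"
  shows "\<forall>s>s0 + 1.
    openin (subtopology (mtop (Q s)) (fixed_point_set G (points (Q s)) (\<Phi> s) H))
      (isotropy_type_set G (points (Q s)) (\<Phi> s) H)"
proof (intro allI impI)
  fix s assume "s > s0 + 1"
  then have s: "s > s0" by simp
  have "Hausdorff_space (mtop M)"
    using assms(3) by (simp add: lie_group_def banach_manifold_def)
  then have closed: "closedin (mtop M) H"
    using assms(6) compactin_imp_closedin by blast
  have man: "banach_manifold (Q s)"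
    using assms(1) s by (simp add: banach_manifold_chain_def)
  have act: "group_action G (points (Q s)) (\<Phi> s)"
    and cont: "continuous_map (prod_topology (mtop M) (mtop (Q s))) (mtop (Q s)) (\<lambda>(g, q). \<Phi> s g q)"
    and proper: "proper_action (mtop M) (mtop (Q s)) (\<Phi> s)"
    using assms(4) s unfolding chain_action_def by blast+
  show "openin (subtopology (mtop (Q s)) (fixed_point_set G (points (Q s)) (\<Phi> s) H))
      (isotropy_type_set G (points (Q s)) (\<Phi> s) H)"
    by (rule isotropy_type_set_openin[OF assms(3,5) closed man act cont proper])
qed

end
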